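(* Let $\mathcal H$ be a nonzero complex Hilbert space. In $M(\mathcal H)$ there are no left-symmetric points, and the right-symmetric points of $M(\mathcal H)$ are precisely the pure rotations, i.e. $M_{\phi_{a,U}}$ is right-symmetric in $M(\mathcal H)$ if and only if $a=0$.
   Context: Let $B$ be the open unit ball of $\mathcal H$ (inner product linear in the first variable). For $a\in B$ and a unitary operator $U$ on $\mathcal H$, put $\alpha(a)=\sqrt{1-\|a\|^2}$, let $P_a$ be the orthogonal projection onto $\mathbb Ca$ and $Q_a=I-P_a$ (so $P_0=0$, $Q_0=I$). The automorphism $\phi_{a,U}\in\operatorname{Aut}(B)$ is $\phi_{a,U}(z)=U\frac{(P_a+\alpha(a)Q_a)z-a}{1-\langle z,a\rangle}$. The associated bounded operator $M_{\phi_{a,U}}$ on the Hilbert space direct sum $\mathcal H\oplus\mathbb C$ is $$M_{\phi_{a,U}}(x,\lambda)=\bigl(U(P_a+\alpha(a)Q_a)x-\lambda Ua,\ -\langle x,a\rangle+\lambda\bigr).$$ $M(\mathcal H)=\{M_{\phi_{a,U}}: a\in B,\ U \text{ unitary on }\mathcal H\}\subset\mathcal B(\mathcal H\oplus\mathbb C)$; the elements $M_{\phi_{0,U}}$ are the pure rotations. For $S,T\in\mathcal B(\mathcal H\oplus\mathbb C)$ (operator norm), $S\perp_B T$ means $\|S+\lambda T\|\ge\|S\|$ for all $\lambda\in\mathbb C$. An element $S\in M(\mathcal H)$ is left-symmetric in $M(\mathcal H)$ if for all $T\in M(\mathcal H)$, $S\perp_B T$ implies $T\perp_B S$; it is right-symmetric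 in $M(\mathcal H)$ if for all $T\in M(\mathcal H)$, $T\perp_B S$ implies $S\perp_B T$. *)

theory Defs
  imports "HOL-Analysis.Analysis"
begin

section \<open>Complex Hilbert spaces\<close>

class complex_vector = real_vector +
  fixes scaleC :: "complex \<Rightarrow> 'a \<Rightarrow> 'a"  (infixr \<open>*\<^sub>C\<close> 75)
  assumes scaleC_add_right: "c *\<^sub>C (x + y) = c *\<^sub>C x + c *\<^sub>C y"
    and scaleC_add_left: "(c + d) *\<^sub>C x = c *\<^sub>C x + d *\<^sub>C x"
    and scaleC_scaleC: "c *\<^sub>C (d *\<^sub>C x) = (c * d) *\<^sub>C x"
    and scaleC_one: "1 *\<^sub>C x = x"
    and scaleR_scaleC: "r *\<^sub>R x = complex_of_real r *\<^sub>C x"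

text \<open>The inner product is linear in the first variable. Positive definiteness is part of
  \<open>norm_eq_sqrt_cinner\<close>, since the norm is already nonnegative and vanishes only at \<open>0\<close>.\<close>

class complex_inner = complex_vector + real_normed_vector +
  fixes cinner :: "'a \<Rightarrow> 'a \<Rightarrow> complex"
  assumes cinner_commute: "cinner x y = cnj (cinner y x)"
    and cinner_add_left: "cinner (x + y) z = cinner x z + cinner y z"
    and cinner_scaleC_left: "cinner (c *\<^sub>C x) y = c * cinner x y"
    and norm_eq_sqrt_cinner: "norm x = sqrt (Re (cinner x x))"

class chilbert_space = complex_inner + complete_space

instantiation complex :: chilbert_space
begin

definition scaleC_complex :: "complex \<Rightarrow> complex \<Rightarrow> complex" where
  "scaleC_complex c x = c * x"

definition cinner_complex :: "complex \<Rightarrow> complex \<Rightarrow> complex" where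
  "cinner_complex x y = x * cnj y"

instance
  by standard
    (simp_all add: scaleC_complex_def cinner_complex_def algebra_simps scaleR_conv_of_real
      cmod_def power2_eq_square)

end

text \<open>Hilbert space direct sum: the library norm on products is already the \<open>\<ell>\<^sup>2\<close> norm.\<close>

instantiation prod :: (complex_vector, complex_vector) complex_vector
begin

definition scaleC_prod :: "complex \<Rightarrow> 'a \<times> 'b \<Rightarrow> 'a \<times> 'b" where
  "scaleC_prod c p = (c *\<^sub>C fst p, c *\<^sub>C snd p)"

instance
  by standard
    (auto simp: scaleC_prod_def prod_eq_iff scaleC_add_right scaleC_add_left scaleC_scaleC
      scaleC_one scaleR_scaleC)

end

lemma Re_cinner_self: "Re (cinner x x) = (norm (x :: 'a::complex_inner))\<^sup>2"
proof -
  have "0 \<le> sqrt (Re (cinner x x))"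
    by (metis norm_eq_sqrt_cinner norm_ge_zero)
  then show ?thesis
    by (simp add: norm_eq_sqrt_cinner)
qed

instantiation prod :: (complex_inner, complex_inner) complex_inner
begin

definition cinner_prod :: "'a \<times> 'b \<Rightarrow> 'a \<times> 'b \<Rightarrow> complex" where
  "cinner_prod p q = cinner (fst p) (fst q) + cinner (snd p) (snd q)"

instance
proof
  fix x y z :: "'a \<times> 'b" and c :: complex
  show "cinner x y = cnj (cinner y x)"
    by (metis cinner_prod_def cinner_commute complex_cnj_add)
  show "cinner (x + y) z = cinner x z + cinner y z"
    by (simp add: cinner_prod_def cinner_add_left)
  show "cinner (c *\<^sub>C x) y = c * cinner x y"
    by (simp add: cinner_prod_def scaleC_prod_def cinner_scaleC_left distrib_left)
  show "norm x = sqrt (Re (cinner x x))"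
    by (simp add: cinner_prod_def norm_prod_def Re_cinner_self)
qed

end

instance prod :: (chilbert_space, chilbert_space) chilbert_space ..

section \<open>Operators\<close>

definition bounded_clinear :: "('a::complex_inner \<Rightarrow> 'b::complex_inner) \<Rightarrow> bool" where
  "bounded_clinear f \<longleftrightarrow> bounded_linear f \<and> (\<forall>c x. f (c *\<^sub>C x) = c *\<^sub>C f x)"

definition unitary :: "('a::complex_inner \<Rightarrow> 'a) \<Rightarrow> bool" where
  "unitary U \<longleftrightarrow> bounded_clinear U \<and> surj U \<and> (\<forall>x y. cinner (U x) (U y) = cinner x y)"

definition cline :: "'a::complex_vector \<Rightarrow> 'a set" where
  "cline a = range (\<lambda>c. c *\<^sub>C a)"

definition orth_proj :: "'a::complex_inner set \<Rightarrow> 'a \<Rightarrow> 'a" where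
  "orth_proj V x = (THE p. p \<in> V \<and> (\<forall>v\<in>V. cinner (x - p) v = 0))"

text \<open>Birkhoff--James orthogonality of bounded operators; \<^const>\<open>onorm\<close> is the operator norm.
  The carrier \<open>A\<close> in the symmetry notions is the set from which the second operator is taken.\<close>

definition BJ_orth :: "('a::complex_inner \<Rightarrow> 'b::complex_inner) \<Rightarrow> ('a \<Rightarrow> 'b) \<Rightarrow> bool" where
  "BJ_orth S T \<longleftrightarrow> (\<forall>c. onorm (\<lambda>x. S x + c *\<^sub>C T x) \<ge> onorm S)"

definition left_symmetric_in ::
  "('a::complex_inner \<Rightarrow> 'b::complex_inner) set \<Rightarrow> ('a \<Rightarrow> 'b) \<Rightarrow> bool" where
  "left_symmetric_in A S \<longleftrightarrow> S \<in> A \<and> (\<forall>T\<in>A. BJ_orth S T \<longrightarrow> BJ_orth T S)"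

definition right_symmetric_in ::
  "('a::complex_inner \<Rightarrow> 'b::complex_inner) set \<Rightarrow> ('a \<Rightarrow> 'b) \<Rightarrow> bool" where
  "right_symmetric_in A S \<longleftrightarrow> S \<in> A \<and> (\<forall>T\<in>A. BJ_orth T S \<longrightarrow> BJ_orth S T)"

section \<open>The operators associated with automorphisms of the unit ball\<close>

definition alpha :: "'a::complex_inner \<Rightarrow> real" where
  "alpha a = sqrt (1 - (norm a)\<^sup>2)"

definition P_proj :: "'a::complex_inner \<Rightarrow> 'a \<Rightarrow> 'a" where
  "P_proj a = orth_proj (cline a)"

definition Q_proj :: "'a::complex_inner \<Rightarrow> 'a \<Rightarrow> 'a" where
  "Q_proj a x = x - P_proj a x"

text \<open>\<open>M_op a U\<close> is the operator attached to the automorphism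
  \<open>z \<mapsto> U ((P\<^sub>a + \<alpha>(a) Q\<^sub>a) z - a) / (1 - \<langle>z, a\<rangle>)\<close>.\<close>

definition M_op ::
  "'a::complex_inner \<Rightarrow> ('a \<Rightarrow> 'a) \<Rightarrow> 'a \<times> complex \<Rightarrow> 'a \<times> complex" where
  "M_op a U = (\<lambda>(x, l). (U (P_proj a x + alpha a *\<^sub>R Q_proj a x) - l *\<^sub>C U a, - cinner x a + l))"

definition M_set :: "('a::complex_inner \<times> complex \<Rightarrow> 'a \<times> complex) set" where
  "M_set = {M_op a U | a U. a \<in> ball 0 1 \<and> unitary U}"

definition pure_rotations :: "('a::complex_inner \<times> complex \<Rightarrow> 'a \<times> complex) set" where
  "pure_rotations = {M_op 0 U | U. unitary U}"

section \<open>The projection is well defined and the operators are bounded\<close>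

lemma scaleC_zero_left [simp]: "0 *\<^sub>C (x :: 'a::complex_vector) = 0"
  using scaleC_add_left[of 0 0 x] by simp

lemma scaleC_minus_left: "(- c) *\<^sub>C (x :: 'a::complex_vector) = - (c *\<^sub>C x)"
  using scaleC_add_left[of c "- c" x] by (simp add: eq_neg_iff_add_eq_0 add.commute)

lemma scaleC_zero_right [simp]: "c *\<^sub>C (0 :: 'a::complex_vector) = 0"
  using scaleC_add_right[of c 0 "0::'a"] by simp

lemma scaleC_minus_right: "c *\<^sub>C (- x) = - (c *\<^sub>C (x :: 'a::complex_vector))"
  using scaleC_add_right[of c x "- x"] by (simp add: eq_neg_iff_add_eq_0 add.commute)

lemma scaleC_diff_right: "c *\<^sub>C (x - y) = c *\<^sub>C x - c *\<^sub>C (y :: 'a::complex_vector)"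
  using scaleC_add_right[of c x "- y"] by (simp add: scaleC_minus_right)

lemma cinner_zero_left [simp]: "cinner 0 (y :: 'a::complex_inner) = 0"
  using cinner_add_left[of 0 0 y] by simp

lemma cinner_minus_left: "cinner (- x) (y :: 'a::complex_inner) = - cinner x y"
  using cinner_add_left[of x "- x" y] by (simp add: eq_neg_iff_add_eq_0 add.commute)

lemma cinner_diff_left: "cinner (x - y) (z :: 'a::complex_inner) = cinner x z - cinner y z"
  using cinner_add_left[of x "- y" z] by (simp add: cinner_minus_left)

lemma cinner_add_right: "cinner x (y + z) = cinner x y + cinner x (z :: 'a::complex_inner)"
  by (metis cinner_add_left cinner_commute complex_cnj_add)

lemma cinner_zero_right [simp]: "cinner x (0 :: 'a::complex_inner) = 0"
  by (metis cinner_commute cinner_zero_left complex_cnj_zero)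

lemma cinner_scaleC_right: "cinner x (c *\<^sub>C y) = cnj c * cinner x (y :: 'a::complex_inner)"
  by (metis cinner_commute cinner_scaleC_left complex_cnj_mult)

lemma cinner_self: "cinner x x = complex_of_real ((norm (x :: 'a::complex_inner))\<^sup>2)"
proof -
  have "cinner x x = cnj (cinner x x)"
    by (rule cinner_commute)
  then have "Im (cinner x x) = 0"
    by (metis cnj.simps(2) equal_neg_zero)
  then show ?thesis
    by (simp add: complex_eq_iff Re_cinner_self del: of_real_power)
qed

lemma norm_scaleC: "norm (c *\<^sub>C x) = cmod c * norm (x :: 'a::complex_inner)"
proof -
  have "cinner (c *\<^sub>C x) (c *\<^sub>C x) = (c * cnj c) * cinner x x"
    by (simp add: cinner_scaleC_left cinner_scaleC_right)
  also have "\<dots> = complex_of_real ((cmod c * norm x)\<^sup>2)"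
    by (simp only: cinner_self complex_norm_square[symmetric] power_mult_distrib of_real_mult
        of_real_power)
  finally have "cinner (c *\<^sub>C x) (c *\<^sub>C x) = complex_of_real ((cmod c * norm x)\<^sup>2)" .
  then have "(norm (c *\<^sub>C x))\<^sup>2 = (cmod c * norm x)\<^sup>2"
    by (metis Re_cinner_self Re_complex_of_real)
  then show ?thesis
    by (simp add: power2_eq_iff_nonneg)
qed

lemma cline_proj_unique:
  fixes a x :: "'a::complex_inner"
  shows "\<exists>!p. p \<in> cline a \<and> (\<forall>v\<in>cline a. cinner (x - p) v = 0)"
    and P_proj_eq: "P_proj a x = (cinner x a / cinner a a) *\<^sub>C a"
proof -
  let ?p = "(cinner x a / cinner a a) *\<^sub>C a"
  have ex: "?p \<in> cline a \<and> (\<forall>v\<in>cline a. cinner (x - ?p) v = 0)"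
    by (cases "a = 0")
      (auto simp: cline_def cinner_scaleC_right cinner_diff_left cinner_scaleC_left cinner_self)
  have un: "q = ?p" if q: "q \<in> cline a \<and> (\<forall>v\<in>cline a. cinner (x - q) v = 0)" for q
  proof -
    obtain c where c: "q = c *\<^sub>C a" using q by (auto simp: cline_def)
    have "a \<in> cline a" unfolding cline_def by (metis rangeI scaleC_one)
    then have "cinner x a = c * cinner a a"
      using q by (simp add: c cinner_diff_left cinner_scaleC_left)
    then show ?thesis
      by (cases "a = 0") (simp_all add: c cinner_self)
  qed
  show "\<exists>!p. p \<in> cline a \<and> (\<forall>v\<in>cline a. cinner (x - p) v = 0)"
    using ex un by blast
  show "P_proj a x = ?p"
    unfolding P_proj_def orth_proj_def using ex un by (rule the_equality)
qed

lemma Re_cinner_le: "Re (cinner x y) \<le> norm x * norm (y :: 'a::complex_inner)"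
proof -
  have "Re (cinner y x) = Re (cinner x y)"
    by (metis cinner_commute cnj.simps(1))
  then have "(norm (x + y))\<^sup>2 = (norm x)\<^sup>2 + 2 * Re (cinner x y) + (norm y)\<^sup>2"
    by (simp flip: Re_cinner_self add: cinner_add_left cinner_add_right)
  moreover have "(norm (x + y))\<^sup>2 \<le> (norm x + norm y)\<^sup>2"
    by (intro power_mono norm_triangle_ineq norm_ge_zero)
  ultimately show ?thesis
    by (simp add: power2_sum)
qed

lemma norm_cinner_le: "cmod (cinner x y) \<le> norm x * norm (y :: 'a::complex_inner)"
proof (cases "cinner x y = 0")
  case False
  define u where "u = cnj (sgn (cinner x y))"
  have "u * cinner x y = complex_of_real (cmod (cinner x y))"
    using False
    by (simp add: u_def sgn_eq complex_norm_square[symmetric] power2_eq_square mult.commute)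
  then have "cmod (cinner x y) = Re (cinner (u *\<^sub>C x) y)"
    by (simp add: cinner_scaleC_left)
  also have "\<dots> \<le> norm (u *\<^sub>C x) * norm y"
    by (rule Re_cinner_le)
  also have "\<dots> = norm x * norm y"
    using False by (simp add: norm_scaleC u_def norm_sgn)
  finally show ?thesis .
qed simp

lemma bounded_clinearI:
  fixes f :: "'a::complex_inner \<Rightarrow> 'b::complex_inner"
  assumes "\<And>x y. f (x + y) = f x + f y" and "\<And>c x. f (c *\<^sub>C x) = c *\<^sub>C f x"
    and "\<And>x. norm (f x) \<le> norm x * K"
  shows "bounded_clinear f"
  unfolding bounded_clinear_def
  using assms by (auto intro!: bounded_linear_intro simp: scaleR_scaleC)

lemma bounded_clinear_P_proj: "bounded_clinear (P_proj (a :: 'a::complex_inner))"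
proof (rule bounded_clinearI)
  show "norm (P_proj a x) \<le> norm x * 1" for x
  proof (cases "a = 0")
    case False
    have "norm (P_proj a x) = cmod (cinner x a) / norm a"
      using False by (simp add: P_proj_eq norm_scaleC norm_divide cinner_self
          power2_eq_square norm_mult)
    then show ?thesis
      using norm_cinner_le[of x a] False by (simp add: divide_le_eq)
  qed (simp add: P_proj_eq)
qed (simp_all add: P_proj_eq cinner_add_left add_divide_distrib scaleC_add_left
      cinner_scaleC_left scaleC_scaleC)

lemma bounded_clinear_M_op:
  assumes "unitary U"
  shows "bounded_clinear (M_op a U)"
proof -
  have U: "bounded_linear U" "\<And>c x. U (c *\<^sub>C x) = c *\<^sub>C U x"
    using assms by (auto simp: unitary_def bounded_clinear_def)
  have P: "bounded_linear (P_proj a)" "\<And>c x. P_proj a (c *\<^sub>C x) = c *\<^sub>C P_proj a x"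
    using bounded_clinear_P_proj[of a] by (auto simp: bounded_clinear_def)
  have c: "bounded_linear (\<lambda>x. cinner x a)"
    by (rule bounded_linear_intro[where K = "norm a"])
      (simp_all add: cinner_add_left scaleR_scaleC cinner_scaleC_left norm_cinner_le
        scaleC_complex_def)
  have s: "bounded_linear (\<lambda>l. l *\<^sub>C U a)"
    by (rule bounded_linear_intro[where K = "norm (U a)"])
      (simp_all add: scaleC_add_left scaleR_scaleC scaleC_scaleC norm_scaleC scaleC_complex_def)
  have "bounded_linear (M_op a U)"
    unfolding M_op_def Q_proj_def case_prod_unfold
    by (intro bounded_linear_Pair bounded_linear_sub bounded_linear_add bounded_linear_minus
        bounded_linear_compose[OF U(1)] bounded_linear_compose[OF P(1)]
        bounded_linear_compose[OF c] bounded_linear_compose[OF s]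
        bounded_linear_compose[OF bounded_linear_scaleR_right]
        bounded_linear_fst bounded_linear_snd)
  moreover have "M_op a U (k *\<^sub>C p) = k *\<^sub>C M_op a U p" for k p
    by (simp add: M_op_def Q_proj_def case_prod_unfold scaleC_prod_def P(2) cinner_scaleC_left
        scaleR_scaleC scaleC_scaleC scaleC_add_right scaleC_diff_right scaleC_complex_def
        algebra_simps flip: U(2))
  ultimately show ?thesis
    by (simp add: bounded_clinear_def)
qed

lemma M_set_bounded_clinear: "M_set \<subseteq> Collect bounded_clinear"
  by (auto simp: M_set_def bounded_clinear_M_op)

end

theory Submission imports Defs begin

text \<open>
  Write \<open>S = M\<^bsub>a,U\<^esub>\<close> and \<open>r = \<parallel>a\<parallel>\<close>. Up to the unitary \<open>U \<oplus> 1\<close>, \<open>S\<close> is a positive operator: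
  on the span of \<open>(a, 0)\<close> and \<open>(0, 1)\<close> it has the eigenvalue \<open>1 + r\<close> on \<open>(a, -r)\<close> and \<open>1 - r\<close>
  on \<open>(a, r)\<close>, and on the orthogonal complement of this plane it is the scalar
  \<open>\<alpha>(a) = sqrt (1 - r\<^sup>2) \<le> 1\<close>. So two very different cases arise. If \<open>a = 0\<close>, then \<open>S\<close> is an
  isometry and every vector is norming. If \<open>a \<noteq> 0\<close>, then the norm \<open>1 + r\<close> is attained only on the
  line of \<open>v\<^sub>a = (a, -r)\<close>, with a spectral gap below it (\<open>M_op_gap\<close>).

  An operator \<open>S\<close> is orthogonal to \<open>T\<close> as soon as \<open>\<langle>S v, T v\<rangle> = 0\<close> for some norming vector \<open>v\<close> of
  \<open>S\<close> (\<open>BJ_orth_if_cinner_eq_0\<close>). When the norming vector is unique up to scalars and there is a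
  gap, this condition is also necessary (\<open>cinner_eq_0_if_BJ_orth\<close>). Hence for \<open>a \<noteq> 0\<close> orthogonality
  of \<open>M\<^bsub>a,U\<^esub>\<close> to \<open>T\<close> is a single scalar equation at \<open>v\<^sub>a\<close> (\<open>BJ_orth_M_op_iff\<close>), while a pure
  rotation can use any vector to be orthogonal to something. This yields the three assertions.

  Pure rotations are right-symmetric: from \<open>T\<close> orthogonal to \<open>S = M\<^bsub>0,U\<^esub>\<close> with \<open>T\<close> not a rotation,
  one gets \<open>\<langle>T v, S v\<rangle> = 0\<close> at the norming vector \<open>v\<close> of \<open>T\<close>, which is norming for the isometry \<open>S\<close>
  too; and between two isometries orthogonality is symmetric because \<open>S + c T\<close> and \<open>T + cnj c S\<close>
  have the same norm at each vector (\<open>right_symmetric_M_op_zero\<close>).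

  For \<open>a \<noteq> 0\<close> there is a rotation \<open>M\<^bsub>0,cU\<^esub>\<close> orthogonal to \<open>M\<^bsub>a,U\<^esub>\<close> but not conversely
  (\<open>rotation_orth_asymmetric\<close>). The pair shows both that \<open>M\<^bsub>a,U\<^esub>\<close> is not right-symmetric and, read
  from the rotation, that no rotation is left-symmetric. Finally, for \<open>a \<noteq> 0\<close> the operator
  \<open>M\<^bsub>b,cU\<^esub>\<close> with \<open>b = (\<i>/2) a\<close> and suitable \<open>c\<close> shows that \<open>M\<^bsub>a,U\<^esub>\<close> is not left-symmetric
  (\<open>not_left_symmetric_M_op\<close>): the two scalar equations for the two directions of orthogonality
  differ.
\<close>

section \<open>Birkhoff--James orthogonality and norming vectors\<close>

lemma norm_add_sq:
  "(norm (x + y))\<^sup>2 = (norm x)\<^sup>2 + 2 * Re (cinner x y) + (norm (y :: 'a::complex_inner))\<^sup>2"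
proof -
  have "Re (cinner y x) = Re (cinner x y)"
    by (metis cinner_commute cnj.simps(1))
  then show ?thesis
    by (simp flip: Re_cinner_self add: cinner_add_left cinner_add_right)
qed

lemma norm_Pair_sq: "(norm (x, y))\<^sup>2 = (norm x)\<^sup>2 + (norm y)\<^sup>2"
  by (simp add: norm_Pair)

lemma bounded_linear_add_scaleC:
  assumes S: "bounded_clinear S" and T: "bounded_clinear T"
  shows "bounded_linear (\<lambda>x. S x + c *\<^sub>C T x)"
proof -
  have "bounded_linear (\<lambda>x. c *\<^sub>C (x :: 'b))"
    by (rule bounded_linear_intro[where K = "cmod c"])
      (simp_all add: scaleC_add_right scaleR_scaleC scaleC_scaleC mult.commute norm_scaleC)
  then have "bounded_linear (\<lambda>x. c *\<^sub>C T x)"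
    using T by (auto simp: bounded_clinear_def intro: bounded_linear_compose)
  with S show ?thesis
    by (simp add: bounded_clinear_def bounded_linear_add)
qed

text \<open>By Pythagoras, adding a multiple of \<open>T\<close> cannot shorten the image of \<open>v\<close>, where \<open>S\<close> already
  attains its norm.\<close>

lemma BJ_orth_if_cinner_eq_0:
  fixes S T :: "'a::complex_inner \<Rightarrow> 'b::complex_inner"
  assumes S: "bounded_clinear S" and T: "bounded_clinear T"
    and v: "v \<noteq> 0" "norm (S v) = onorm S * norm v" and orth: "cinner (S v) (T v) = 0"
  shows "BJ_orth S T"
  unfolding BJ_orth_def
proof
  fix c
  have "(norm (S v))\<^sup>2 \<le> (norm (S v + c *\<^sub>C T v))\<^sup>2"
    by (simp add: norm_add_sq cinner_scaleC_right orth)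
  then have "onorm S * norm v \<le> norm (S v + c *\<^sub>C T v)"
    using v(2) by (simp add: power2_le_iff_abs_le)
  also have "\<dots> \<le> onorm (\<lambda>x. S x + c *\<^sub>C T x) * norm v"
    using onorm[OF bounded_linear_add_scaleC[OF S T]] .
  finally show "onorm S \<le> onorm (\<lambda>x. S x + c *\<^sub>C T x)"
    using v(1) by simp
qed

text \<open>The gap hypothesis says that \<open>S\<close> stays below its norm \<open>N\<close> by an amount controlled by the
  component \<open>y\<close> of \<open>x\<close> orthogonal to the norming vector \<open>v\<close>. If \<open>\<langle>S v, T v\<rangle>\<close> were nonzero, the small
  perturbation \<open>S + c T\<close>, with the phase of \<open>c\<close> chosen against this scalar, would shrink vectors
  near the line of \<open>v\<close> to first order in \<open>\<bar>c\<bar> = t\<close>. The cross terms with \<open>y\<close> are also of first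
  order, but the gap absorbs them at a cost of order \<open>t\<^sup>2\<close>; so the norm would drop below \<open>N\<close>.\<close>

lemma cinner_eq_0_if_BJ_orth:
  fixes S T :: "'a::complex_inner \<Rightarrow> 'b::complex_inner"
  assumes S: "bounded_clinear S" and T: "bounded_clinear T"
    and v: "v \<noteq> 0" "norm (S v) = N * norm v" and \<delta>: "\<delta> > 0" and N: "N \<ge> 0"
    and gap: "\<And>x. \<exists>p y. x = p *\<^sub>C v + y \<and> cinner v y = 0 \<and>
                (norm (S x))\<^sup>2 \<le> N\<^sup>2 * (norm x)\<^sup>2 - \<delta> * (norm y)\<^sup>2"
    and BJ: "BJ_orth S T"
  shows "cinner (S v) (T v) = 0"
proof (rule ccontr)
  define g where "g = cinner (S v) (T v)"
  assume "cinner (S v) (T v) \<noteq> 0"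
  then have g: "g \<noteq> 0" by (simp add: g_def)
  have bS: "bounded_linear S" and cS: "\<And>c x. S (c *\<^sub>C x) = c *\<^sub>C S x"
    using S by (auto simp: bounded_clinear_def)
  have bT: "bounded_linear T" and cT: "\<And>c x. T (c *\<^sub>C x) = c *\<^sub>C T x"
    using T by (auto simp: bounded_clinear_def)
  note addS = linear_add[OF bounded_linear.linear[OF bS]]
  note addT = linear_add[OF bounded_linear.linear[OF bT]]
  define D where "D = cmod g / (norm v)\<^sup>2"
  have D: "D > 0" using g v by (simp add: D_def)
  define K where "K = 2 * onorm S * onorm T"
  have S0: "onorm S \<ge> 0" and T0: "onorm T \<ge> 0"
    using onorm_pos_le[OF bS] onorm_pos_le[OF bT] .
  define L where "L = (onorm T)\<^sup>2 + 2 * K\<^sup>2 / \<delta>"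
  have L: "L \<ge> 0" using \<delta> by (simp add: L_def)
  \<comment> \<open>The first bound lets half of the gap pay for replacing \<open>\<parallel>p v\<parallel>\<^sup>2\<close> by \<open>\<parallel>x\<parallel>\<^sup>2\<close>; the second makes
    the second-order terms, collected in \<open>L\<close>, at most half of the first-order gain \<open>2 t D\<close>.\<close>
  define t where "t = min (\<delta> / (4 * D)) (D / (L + 1))"
  have t: "t > 0" "2 * t * D \<le> \<delta> / 2" "t * L \<le> D"
  proof -
    show "t > 0" using \<delta> D L by (simp add: t_def)
    have "t \<le> \<delta> / (4 * D)" by (simp add: t_def)
    then show "2 * t * D \<le> \<delta> / 2" using D by (simp add: field_simps)
    have "t \<le> D / (L + 1)" by (simp add: t_def)
    then have "t * (L + 1) \<le> D" using L by (simp add: field_simps)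
    then show "t * L \<le> D" using \<open>t > 0\<close> by (simp add: algebra_simps)
  qed
  define u where "u = g / cmod g"
  have u: "cmod u = 1" "cnj u * g = cmod g"
    using g by (simp_all add: u_def norm_divide complex_norm_square[symmetric] power2_eq_square
        mult.commute)
  define c where "c = - (t * u)"
  have cc: "cmod c = t" using t u by (simp add: c_def norm_mult)
  have bound: "norm (S x + c *\<^sub>C T x) \<le> sqrt (N\<^sup>2 - t * D) * norm x" for x
  proof -
    obtain p y where x: "x = p *\<^sub>C v + y" and vy: "cinner v y = 0"
      and gapx: "(norm (S x))\<^sup>2 \<le> N\<^sup>2 * (norm x)\<^sup>2 - \<delta> * (norm y)\<^sup>2"
      using gap by blast
    have nx: "(norm x)\<^sup>2 = (cmod p)\<^sup>2 * (norm v)\<^sup>2 + (norm y)\<^sup>2"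
      by (simp add: x norm_add_sq cinner_scaleC_left vy norm_scaleC power_mult_distrib)
    have pv: "cmod p * norm v \<le> norm x"
      by (rule power2_le_imp_le) (simp_all add: nx power_mult_distrib)
    \<comment> \<open>Every part of \<open>\<langle>S x, T x\<rangle>\<close> involving \<open>y\<close> is an error of size \<open>\<parallel>x\<parallel> \<parallel>y\<parallel>\<close>.\<close>
    define e where "e = cinner (p *\<^sub>C S v) (T y) + cinner (S y) (T x)"
    have "cinner (S x) (T x) = cinner (p *\<^sub>C S v) (T x) + cinner (S y) (T x)"
      by (simp add: x addS cS cinner_add_left)
    also have "cinner (p *\<^sub>C S v) (T x) = p * cnj p * g + cinner (p *\<^sub>C S v) (T y)"
      by (simp add: x addT cT cinner_add_right cinner_scaleC_left cinner_scaleC_right g_def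
          mult_ac)
    finally have ST: "cinner (S x) (T x) = complex_of_real ((cmod p)\<^sup>2) * g + e"
      by (simp add: e_def complex_norm_square del: of_real_power)
    have e: "cmod e \<le> K * norm x * norm y"
    proof -
      have "cmod (cinner (p *\<^sub>C S v) (T y)) \<le> (cmod p * (onorm S * norm v)) * (onorm T * norm y)"
        by (rule order_trans[OF norm_cinner_le], unfold norm_scaleC)
          (intro mult_mono mult_left_mono onorm bS bT; simp add: S0 T0)
      also have "\<dots> = onorm S * onorm T * norm y * (cmod p * norm v)"
        by simp
      also have "\<dots> \<le> onorm S * onorm T * norm y * norm x"
        by (intro mult_left_mono pv) (simp add: S0 T0)
      finally have 1: "cmod (cinner (p *\<^sub>C S v) (T y)) \<le> onorm S * onorm T * norm y * norm x" .
      have 2: "cmod (cinner (S y) (T x)) \<le> (onorm S * norm y) * (onorm T * norm x)"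
        by (rule order_trans[OF norm_cinner_le])
          (intro mult_mono onorm bS bT; simp add: S0 T0)
      show ?thesis
        using norm_triangle_ineq[of "cinner (p *\<^sub>C S v) (T y)" "cinner (S y) (T x)"] 1 2
        by (simp add: e_def K_def mult_ac)
    qed
    define R where "R = Re (cinner (S x) (c *\<^sub>C T x))"
    have "R \<le> - (t * D * (norm x)\<^sup>2) + t * D * (norm y)\<^sup>2 + t * (K * norm x * norm y)"
    proof -
      have "cinner (S x) (c *\<^sub>C T x) = - t * (cmod p)\<^sup>2 * (cnj u * g) + cnj c * e"
        by (simp add: cinner_scaleC_right ST c_def algebra_simps)
      then have "R = - (t * ((cmod p)\<^sup>2 * cmod g)) + Re (cnj c * e)"
        by (simp add: u R_def)
      moreover have "(cmod p)\<^sup>2 * cmod g = D * ((norm x)\<^sup>2 - (norm y)\<^sup>2)"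
        using v by (simp add: nx D_def)
      moreover have "Re (cnj c * e) \<le> t * (K * norm x * norm y)"
      proof -
        have "Re (cnj c * e) \<le> cmod (cnj c * e)" by (rule complex_Re_le_cmod)
        also have "\<dots> = t * cmod e" by (simp add: norm_mult cc)
        also have "\<dots> \<le> t * (K * norm x * norm y)" using e t by (intro mult_left_mono) auto
        finally show ?thesis .
      qed
      ultimately show ?thesis by (simp only: right_diff_distrib mult.assoc)
    qed
    \<comment> \<open>Arithmetic-geometric mean, weighted so that the other half of the gap absorbs the
      \<open>\<parallel>y\<parallel>\<^sup>2\<close> part.\<close>
    moreover have "2 * (t * (K * norm x * norm y))
        \<le> \<delta> / 2 * (norm y)\<^sup>2 + t\<^sup>2 * (2 * K\<^sup>2 / \<delta>) * (norm x)\<^sup>2"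
    proof -
      have "0 \<le> (\<delta> * norm y - 2 * t * K * norm x)\<^sup>2 / (2 * \<delta>)"
        using \<delta> by simp
      also have "\<dots> = \<delta> / 2 * (norm y)\<^sup>2 + t\<^sup>2 * (2 * K\<^sup>2 / \<delta>) * (norm x)\<^sup>2
          - 2 * (t * (K * norm x * norm y))"
        using \<delta> by (simp add: field_simps power2_eq_square)
      finally show ?thesis by simp
    qed
    moreover have "2 * (t * D * (norm y)\<^sup>2) \<le> \<delta> / 2 * (norm y)\<^sup>2"
      using mult_right_mono[OF t(2), of "(norm y)\<^sup>2"] by (simp add: mult.assoc)
    moreover have "(norm (c *\<^sub>C T x))\<^sup>2 \<le> t\<^sup>2 * (onorm T)\<^sup>2 * (norm x)\<^sup>2"
      unfolding norm_scaleC cc power_mult_distrib mult.assoc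
      using power_mono[OF onorm[OF bT, of x], of 2]
      by (intro mult_left_mono) (simp_all add: power_mult_distrib)
    moreover have "t\<^sup>2 * (onorm T)\<^sup>2 * (norm x)\<^sup>2 + t\<^sup>2 * (2 * K\<^sup>2 / \<delta>) * (norm x)\<^sup>2
        \<le> t * D * (norm x)\<^sup>2"
    proof -
      have "t * (t * L) * (norm x)\<^sup>2 \<le> t * D * (norm x)\<^sup>2"
        using t by (intro mult_right_mono mult_left_mono) auto
      moreover have "t * (t * L) * (norm x)\<^sup>2
          = t\<^sup>2 * (onorm T)\<^sup>2 * (norm x)\<^sup>2 + t\<^sup>2 * (2 * K\<^sup>2 / \<delta>) * (norm x)\<^sup>2"
        by (simp add: L_def power2_eq_square distrib_left distrib_right mult.assoc)
      ultimately show ?thesis by simp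
    qed
    ultimately have "(norm (S x + c *\<^sub>C T x))\<^sup>2 \<le> (N\<^sup>2 - t * D) * (norm x)\<^sup>2"
      using gapx unfolding norm_add_sq[of "S x"] R_def[symmetric] left_diff_distrib
      by linarith
    then have "norm (S x + c *\<^sub>C T x) \<le> sqrt ((N\<^sup>2 - t * D) * (norm x)\<^sup>2)"
      by (rule real_le_rsqrt)
    then show ?thesis by (simp add: real_sqrt_mult)
  qed
  have "N * norm v \<le> onorm S * norm v"
    using onorm[OF bS, of v] v by simp
  then have "N \<le> onorm S" using v by simp
  also have "\<dots> \<le> onorm (\<lambda>x. S x + c *\<^sub>C T x)"
    using BJ by (simp add: BJ_orth_def)
  also have "\<dots> \<le> sqrt (N\<^sup>2 - t * D)"
  proof (rule onorm_bound[OF _ bound])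
    have "0 \<le> sqrt (N\<^sup>2 - t * D) * norm v"
      using norm_ge_zero bound by (rule order_trans)
    then show "0 \<le> sqrt (N\<^sup>2 - t * D)"
      using v(1) by (simp only: zero_le_mult_iff) (auto simp: zero_less_norm_iff)
  qed
  also have "\<dots> < sqrt (N\<^sup>2)"
    using t D by (intro real_sqrt_less_mono) simp
  finally show False using N by simp
qed

section \<open>The norm of the operators\<close>

lemma cinner_Pair [simp]: "cinner (x, l) (y, m) = cinner x y + l * cnj (m :: complex)"
  by (simp add: cinner_prod_def cinner_complex_def)

lemma unitaryD:
  assumes "unitary U"
  shows "U (x + y) = U x + U y" "U (c *\<^sub>C x) = c *\<^sub>C U x" "cinner (U x) (U y) = cinner x y"
    "norm (U x) = norm x"
proof -
  from assms have "linear U"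
    by (auto simp: unitary_def bounded_clinear_def bounded_linear.linear)
  then show "U (x + y) = U x + U y" by (rule linear_add)
  show "U (c *\<^sub>C x) = c *\<^sub>C U x" using assms by (simp add: unitary_def bounded_clinear_def)
  show "cinner (U x) (U y) = cinner x y" for x y using assms by (simp add: unitary_def)
  then show "norm (U x) = norm x" unfolding norm_eq_sqrt_cinner by simp
qed

lemma unitary_scaleC:
  fixes U :: "'a::complex_inner \<Rightarrow> 'a"
  assumes U: "unitary U" and c: "cmod c = 1"
  shows "unitary (\<lambda>x. c *\<^sub>C U x)"
proof -
  have c': "c * cnj c = 1"
    using c by (simp add: complex_norm_square[symmetric])
  have "bounded_clinear (\<lambda>x. c *\<^sub>C U x)"
    by (rule bounded_clinearI[where K = 1])
      (simp_all add: unitaryD[OF U] scaleC_add_right scaleC_scaleC mult.commute norm_scaleC c)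
  moreover have "surj (\<lambda>x. c *\<^sub>C U x)"
  proof (rule surjI)
    fix y
    have "U (inv U (cnj c *\<^sub>C y)) = cnj c *\<^sub>C y"
      using U by (simp add: unitary_def surj_f_inv_f)
    then show "c *\<^sub>C U (inv U (cnj c *\<^sub>C y)) = y"
      by (simp add: scaleC_scaleC c' scaleC_one)
  qed
  moreover have "cinner (c *\<^sub>C U x) (c *\<^sub>C U y) = cinner x y" for x y
  proof -
    have "cinner (c *\<^sub>C U x) (c *\<^sub>C U y) = (c * cnj c) * cinner x y"
      by (simp add: unitaryD[OF U] cinner_scaleC_left cinner_scaleC_right)
    then show ?thesis by (simp add: c')
  qed
  ultimately show ?thesis
    unfolding unitary_def by blast
qed

lemma M_op_zero: "M_op 0 U (x, l) = (U x - l *\<^sub>C U 0, l)"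
  by (simp add: M_op_def alpha_def Q_proj_def P_proj_eq)

lemma M_op_zero_unitary:
  assumes "unitary U" shows "M_op 0 U (x, l) = (U x, l)"
  using unitaryD(2)[OF assms, of 0 0] by (simp add: M_op_zero)

lemma norm_M_op_zero:
  assumes "unitary U" shows "norm (M_op 0 U w) = norm w"
  by (cases w) (simp add: M_op_zero_unitary assms norm_Pair unitaryD(4))

lemma onorm_M_op_zero:
  fixes U :: "'a::complex_inner \<Rightarrow> 'a"
  assumes "unitary U" shows "onorm (M_op 0 U) = 1"
proof (rule antisym)
  show "onorm (M_op 0 U) \<le> 1"
    by (rule onorm_bound) (simp_all add: norm_M_op_zero assms)
  have "bounded_linear (M_op 0 U)"
    using bounded_clinear_M_op[OF assms] by (simp add: bounded_clinear_def)
  from onorm[OF this, of "(0, 1)"] show "onorm (M_op 0 U) \<ge> 1"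
    by (simp add: norm_M_op_zero assms norm_Pair)
qed

text \<open>Stating the action in terms of the coordinate along \<open>a\<close> itself, rather than along the unit
  vector \<open>a / \<parallel>a\<parallel>\<close>, keeps the formula valid for \<open>a = 0\<close> and free of quotients.\<close>

lemma M_op_decomp:
  fixes a q :: "'a::complex_inner"
  assumes U: "unitary U" and q: "cinner q a = 0"
  shows "M_op a U (s *\<^sub>C a + q, l) =
    (U ((s - l) *\<^sub>C a + alpha a *\<^sub>R q), l - s * complex_of_real ((norm a)\<^sup>2))"
proof -
  have P: "P_proj a (s *\<^sub>C a + q) = s *\<^sub>C a"
    by (cases "a = 0") (simp_all add: P_proj_eq cinner_add_left cinner_scaleC_left q cinner_self)
  have "U (s *\<^sub>C a + alpha a *\<^sub>R q) - l *\<^sub>C U a = U ((s - l) *\<^sub>C a + alpha a *\<^sub>R q)"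
    using scaleC_add_left[of "s - l" l a]
    by (simp add: unitaryD[OF U] scaleC_add_right scaleR_scaleC)
  then show ?thesis
    by (simp add: M_op_def Q_proj_def P cinner_add_left cinner_scaleC_left q cinner_self)
qed

lemma M_op_line:
  fixes a :: "'a::complex_inner"
  assumes "unitary U"
  shows "M_op a U (s *\<^sub>C a, l) = ((s - l) *\<^sub>C U a, l - s * complex_of_real ((norm a)\<^sup>2))"
  using M_op_decomp[OF assms, of 0 a s l] by (simp add: unitaryD[OF assms])

text \<open>The eigenvector of the positive part of \<open>M_op a U\<close> for its largest eigenvalue
  \<open>1 + norm a\<close>.\<close>

definition norming_vector :: "'a::complex_inner \<Rightarrow> 'a \<times> complex" where
  "norming_vector a = (a, - complex_of_real (norm a))"

lemma norming_vector_nonzero: "a \<noteq> 0 \<Longrightarrow> norming_vector a \<noteq> 0"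
  by (simp add: norming_vector_def zero_prod_def)

lemma M_op_norming_vector:
  fixes a :: "'a::complex_inner"
  assumes "unitary U"
  shows "M_op a U (norming_vector a) =
    complex_of_real (1 + norm a) *\<^sub>C (U a, - complex_of_real (norm a))"
  using M_op_line[OF assms, of a 1 "- complex_of_real (norm a)"]
  by (simp add: norming_vector_def scaleC_one scaleC_prod_def scaleC_complex_def algebra_simps
      power2_eq_square)

lemma norm_M_op_norming_vector:
  fixes a :: "'a::complex_inner"
  assumes "unitary U"
  shows "norm (M_op a U (norming_vector a)) = (1 + norm a) * norm (norming_vector a)"
proof -
  have "cmod (complex_of_real (1 + norm a)) = 1 + norm a"
    by (simp del: of_real_add)
  then show ?thesis
    unfolding M_op_norming_vector[OF assms] norm_scaleC
    by (simp add: norm_Pair unitaryD(4)[OF assms] norming_vector_def del: of_real_add)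
qed

text \<open>The orthogonal complement of the norming vector is spanned by the eigenvector for \<open>1 - norm a\<close>
  and by the vectors \<open>(q, 0)\<close> with \<open>q\<close> orthogonal to \<open>a\<close>, where the operator acts with norm
  \<open>alpha a\<close>. With \<open>r = norm a\<close>, the squared eigenvalues fall short of \<open>(1 + r)\<^sup>2\<close> by \<open>4 r\<close> and by
  \<open>2 r + 2 r\<^sup>2\<close>, so \<open>2 r\<close> works for both.\<close>

lemma M_op_gap:
  fixes a :: "'a::complex_inner"
  assumes U: "unitary U" and a: "a \<noteq> 0" "norm a < 1"
  shows "\<exists>p y. x = p *\<^sub>C norming_vector a + y \<and> cinner (norming_vector a) y = 0 \<and>
    (norm (M_op a U x))\<^sup>2 \<le> (1 + norm a)\<^sup>2 * (norm x)\<^sup>2 - 2 * norm a * (norm y)\<^sup>2"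
proof -
  define r where "r = norm a"
  have r: "r > 0" "r < 1" using a by (auto simp: r_def)
  obtain z l where x: "x = (z, l)" by (cases x)
  define s where "s = cinner z a / cinner a a"
  define q where "q = z - s *\<^sub>C a"
  have q: "cinner q a = 0"
    using a by (simp add: q_def s_def cinner_diff_left cinner_scaleC_left cinner_self)
  have q': "cinner a q = 0"
    by (metis q cinner_commute complex_cnj_zero)
  have z: "z = s *\<^sub>C a + q" by (simp add: q_def)
  \<comment> \<open>After rescaling the last coordinate to \<open>m\<close>, the two eigenvectors \<open>(a, -r)\<close> and \<open>(a, r)\<close>
    correspond to \<open>(1, -1)\<close> and \<open>(1, 1)\<close> in the coordinates \<open>(s, m)\<close>; \<open>p\<close> and \<open>k\<close> are the
    coefficients with respect to them.\<close>
  define m where "m = l / r"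
  have l: "l = r * m" using r by (simp add: m_def)
  define p where "p = (s - m) / 2"
  define k where "k = (s + m) / 2"
  have spk: "s = p + k" and mpk: "m = k - p" by (simp_all add: p_def k_def field_simps)
  define y where "y = (k *\<^sub>C a + q, r * k)"
  have "x = p *\<^sub>C norming_vector a + y"
    by (simp add: x z l y_def norming_vector_def scaleC_prod_def scaleC_complex_def
        r_def[symmetric] spk mpk scaleC_add_left algebra_simps)
  moreover have "cinner (norming_vector a) y = 0"
    by (simp add: norming_vector_def y_def cinner_add_right cinner_scaleC_right q' cinner_self
        r_def[symmetric] power2_eq_square)
  moreover have "(norm (M_op a U x))\<^sup>2 \<le> (1 + r)\<^sup>2 * (norm x)\<^sup>2 - 2 * r * (norm y)\<^sup>2"
  proof -
    have nl: "(norm (h *\<^sub>C a + b *\<^sub>R q))\<^sup>2 = (cmod h)\<^sup>2 * r\<^sup>2 + b\<^sup>2 * (norm q)\<^sup>2" for h b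
      by (simp add: norm_add_sq norm_scaleC cinner_scaleC_left scaleR_scaleC cinner_scaleC_right q'
          power_mult_distrib r_def)
    have nx: "(norm x)\<^sup>2 = (cmod s)\<^sup>2 * r\<^sup>2 + (norm q)\<^sup>2 + r\<^sup>2 * (cmod m)\<^sup>2"
      using nl[of s 1] by (simp add: x norm_Pair z l norm_mult power_mult_distrib)
    have ny: "(norm y)\<^sup>2 = (cmod k)\<^sup>2 * r\<^sup>2 + (norm q)\<^sup>2 + r\<^sup>2 * (cmod k)\<^sup>2"
      using nl[of k 1] by (simp add: y_def norm_Pair norm_mult power_mult_distrib)
    have al: "(alpha a)\<^sup>2 = 1 - r\<^sup>2"
      using r by (simp add: alpha_def r_def[symmetric] power_le_one)
    have nM: "(norm (M_op a U x))\<^sup>2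
        = (cmod (s - r * m))\<^sup>2 * r\<^sup>2 + (1 - r\<^sup>2) * (norm q)\<^sup>2 + r\<^sup>2 * (cmod (m - r * s))\<^sup>2"
    proof -
      have "l - s * complex_of_real ((norm a)\<^sup>2) = r * (m - r * s)"
        by (simp add: l r_def[symmetric] algebra_simps power2_eq_square)
      then have "(cmod (l - s * complex_of_real ((norm a)\<^sup>2)))\<^sup>2 = r\<^sup>2 * (cmod (m - r * s))\<^sup>2"
        by (simp add: norm_mult power_mult_distrib)
      then show ?thesis
        unfolding x z M_op_decomp[OF U q]
        using nl[of "s - l" "alpha a"]
        by (simp only: norm_Pair_sq unitaryD(4)[OF U] al l)
    qed
    have "(1 + r)\<^sup>2 * (norm x)\<^sup>2 - 2 * r * (norm y)\<^sup>2 - (norm (M_op a U x))\<^sup>2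
        = 4 * r ^ 3 * (cmod k)\<^sup>2 + 2 * r\<^sup>2 * (norm q)\<^sup>2"
      unfolding nx ny nM spk mpk cmod_power2
      by (simp add: power2_eq_square power3_eq_cube algebra_simps)
    also have "\<dots> \<ge> 0" using r by simp
    finally show ?thesis by simp
  qed
  ultimately show ?thesis unfolding r_def by blast
qed

lemma onorm_M_op:
  fixes a :: "'a::complex_inner"
  assumes U: "unitary U" and a: "a \<noteq> 0" "norm a < 1"
  shows "onorm (M_op a U) = 1 + norm a"
proof (rule antisym)
  show "onorm (M_op a U) \<le> 1 + norm a"
  proof (rule onorm_bound)
    show "0 \<le> 1 + norm a" by simp
    fix x
    obtain y :: "'a \<times> complex" where
      "(norm (M_op a U x))\<^sup>2 \<le> (1 + norm a)\<^sup>2 * (norm x)\<^sup>2 - 2 * norm a * (norm y)\<^sup>2"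
      using M_op_gap[OF assms] by blast
    also have "\<dots> \<le> ((1 + norm a) * norm x)\<^sup>2"
      by (simp add: power_mult_distrib)
    finally show "norm (M_op a U x) \<le> (1 + norm a) * norm x"
      by (rule power2_le_imp_le) simp
  qed
  have "bounded_linear (M_op a U)"
    using bounded_clinear_M_op[OF U] by (simp add: bounded_clinear_def)
  from onorm[OF this, of "norming_vector a"] show "1 + norm a \<le> onorm (M_op a U)"
    using norming_vector_nonzero[OF a(1)] by (simp add: norm_M_op_norming_vector[OF U])
qed

text \<open>The left argument of the inner product is the image of the norming vector divided by the
  nonzero factor \<open>1 + norm a\<close>.\<close>

lemma BJ_orth_M_op_iff:
  fixes a :: "'a::complex_inner"
  assumes U: "unitary U" and a: "a \<noteq> 0" "norm a < 1" and T: "bounded_clinear T"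
  shows "BJ_orth (M_op a U) T \<longleftrightarrow>
    cinner (U a, - complex_of_real (norm a)) (T (norming_vector a)) = 0"
proof -
  note S = bounded_clinear_M_op[OF U, of a]
  note v = norming_vector_nonzero[OF a(1)]
  have "BJ_orth (M_op a U) T \<longleftrightarrow> cinner (M_op a U (norming_vector a)) (T (norming_vector a)) = 0"
  proof
    show "BJ_orth (M_op a U) T" if "cinner (M_op a U (norming_vector a)) (T (norming_vector a)) = 0"
      using BJ_orth_if_cinner_eq_0[OF S T v _ that]
      by (simp add: onorm_M_op[OF U a] norm_M_op_norming_vector[OF U])
    show "cinner (M_op a U (norming_vector a)) (T (norming_vector a)) = 0" if "BJ_orth (M_op a U) T"
      by (rule cinner_eq_0_if_BJ_orth[OF S T v norm_M_op_norming_vector[OF U] _ _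
            M_op_gap[OF U a] that]) (use a in auto)
  qed
  moreover have "complex_of_real (1 + norm a) \<noteq> 0"
    unfolding of_real_eq_0_iff using norm_ge_zero[of a] by linarith
  ultimately show ?thesis
    unfolding M_op_norming_vector[OF U] cinner_scaleC_left by (simp del: of_real_add)
qed

section \<open>Symmetric points\<close>

lemma M_op_in_M_set: "unitary U \<Longrightarrow> norm a < 1 \<Longrightarrow> M_op a U \<in> M_set"
  by (auto simp: M_set_def)

text \<open>A rotation preserves all norms, so whatever vector witnesses that \<open>T\<close> is orthogonal to it is
  also norming for the rotation. Only when \<open>T\<close> is itself a rotation is there no
  distinguished witness; there the roles of the two operators can be exchanged at the level of
  norms.\<close>

lemma right_symmetric_M_op_zero:
  fixes U :: "'a::complex_inner \<Rightarrow> 'a"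
  assumes U: "unitary U"
  shows "right_symmetric_in M_set (M_op 0 U)"
  unfolding right_symmetric_in_def
proof (intro conjI ballI impI)
  show "M_op 0 U \<in> M_set" using U by (simp add: M_op_in_M_set)
  fix T :: "'a \<times> complex \<Rightarrow> 'a \<times> complex"
  assume "T \<in> M_set" and BJ: "BJ_orth T (M_op 0 U)"
  then obtain b V where T: "T = M_op b V" and V: "unitary V" and b: "norm b < 1"
    by (auto simp: M_set_def)
  note S = bounded_clinear_M_op[OF U, of 0] and T' = bounded_clinear_M_op[OF V, of b]
  show "BJ_orth (M_op 0 U) T"
  proof (cases "b = 0")
    case True
    have "onorm (\<lambda>x. M_op 0 U x + c *\<^sub>C M_op 0 V x) = onorm (\<lambda>x. M_op 0 V x + cnj c *\<^sub>C M_op 0 U x)"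
      for c
    proof -
      have "norm (M_op 0 U x + c *\<^sub>C M_op 0 V x) = norm (M_op 0 V x + cnj c *\<^sub>C M_op 0 U x)" for x
      proof -
        \<comment> \<open>Both operators are isometric, so the two sums differ at most in the cross term, which is
          replaced by its complex conjugate.\<close>
        have "Re (cinner (M_op 0 U x) (c *\<^sub>C M_op 0 V x))
            = Re (cinner (M_op 0 V x) (cnj c *\<^sub>C M_op 0 U x))"
          unfolding cinner_scaleC_right cinner_commute[of "M_op 0 V x"] by simp
        then have "(norm (M_op 0 U x + c *\<^sub>C M_op 0 V x))\<^sup>2
            = (norm (M_op 0 V x + cnj c *\<^sub>C M_op 0 U x))\<^sup>2"
          by (simp add: norm_add_sq norm_scaleC norm_M_op_zero U V)
        then show ?thesis by simp
      qed
      then show ?thesis by (simp add: onorm_def)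
    qed
    then show ?thesis
      using BJ by (simp add: T True BJ_orth_def onorm_M_op_zero U V)
  next
    case False
    have "cinner (M_op b V (norming_vector b)) (M_op 0 U (norming_vector b)) = 0"
      using BJ BJ_orth_M_op_iff[OF V False b S]
      by (simp add: T M_op_norming_vector[OF V] cinner_scaleC_left del: cinner_Pair)
    then have "cinner (M_op 0 U (norming_vector b)) (T (norming_vector b)) = 0"
      unfolding T by (metis cinner_commute complex_cnj_zero)
    moreover note norming_vector_nonzero[OF False]
    ultimately show ?thesis
      using S T' by (intro BJ_orth_if_cinner_eq_0[of _ _ "norming_vector b"])
        (simp_all add: T norm_M_op_zero onorm_M_op_zero U)
  qed
qed

text \<open>Put \<open>r = norm a\<close>. The orthogonality of \<open>M_op a U\<close> to the rotation by \<open>c U\<close> must be tested at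
  the norming vector of \<open>a\<close> and holds only for \<open>c = -1\<close>. In the other direction every vector is
  norming: for \<open>\<bar>\<sigma>\<bar> = 1\<close> the vector \<open>(\<sigma> a, r)\<close> is a witness precisely when
  \<open>cnj c = - (1 - r \<sigma>) / (1 - r cnj \<sigma>)\<close>, which is a number of modulus one. Real \<open>\<sigma>\<close> only gives
  \<open>c = -1\<close>; the choice \<open>\<sigma> = \<i>\<close> gives another \<open>c\<close>.\<close>

lemma rotation_orth_asymmetric:
  fixes a :: "'a::complex_inner"
  assumes U: "unitary U" and a: "a \<noteq> 0" "norm a < 1"
    and c: "c = - (1 + \<i> * norm a) / (1 - \<i> * norm a)"
  shows "BJ_orth (M_op 0 (\<lambda>x. c *\<^sub>C U x)) (M_op a U)"
    and "\<not> BJ_orth (M_op a U) (M_op 0 (\<lambda>x. c *\<^sub>C U x))"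
    and "cmod c = 1"
proof -
  define r where "r = norm a"
  have r: "r > 0" using a by (simp add: r_def)
  have nz: "1 - \<i> * complex_of_real r \<noteq> 0" "1 + \<i> * complex_of_real r \<noteq> 0"
    by (auto simp: complex_eq_iff)
  have "cmod (1 + \<i> * r) = cmod (1 - \<i> * r)"
    by (simp add: cmod_def)
  then show c1: "cmod c = 1"
    using nz unfolding c r_def[symmetric] norm_divide norm_minus_cancel by simp
  have ceq: "c * (1 - \<i> * r) = - (1 + \<i> * r)"
    using nz by (simp add: c r_def[symmetric])
  note cU = unitary_scaleC[OF U c1]
  note T = bounded_clinear_M_op[OF cU, of 0] and S = bounded_clinear_M_op[OF U, of a]
  define w where "w = (\<i> *\<^sub>C a, complex_of_real r)"
  have "cinner (M_op 0 (\<lambda>x. c *\<^sub>C U x) w) (M_op a U w)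
      = r\<^sup>2 * (c * (1 - \<i> * r) + (1 + \<i> * r))"
    unfolding w_def M_op_zero_unitary[OF cU] M_op_line[OF U] cinner_Pair
    by (simp add: unitaryD[OF U] cinner_scaleC_left cinner_scaleC_right cinner_self
        r_def[symmetric] algebra_simps power2_eq_square)
  then have "cinner (M_op 0 (\<lambda>x. c *\<^sub>C U x) w) (M_op a U w) = 0"
    by (simp add: ceq)
  moreover have "w \<noteq> 0" using r by (simp add: w_def zero_prod_def)
  ultimately show "BJ_orth (M_op 0 (\<lambda>x. c *\<^sub>C U x)) (M_op a U)"
    using S T by (intro BJ_orth_if_cinner_eq_0[of _ _ w])
      (simp_all add: norm_M_op_zero onorm_M_op_zero cU)
  show "\<not> BJ_orth (M_op a U) (M_op 0 (\<lambda>x. c *\<^sub>C U x))"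
  proof
    assume "BJ_orth (M_op a U) (M_op 0 (\<lambda>x. c *\<^sub>C U x))"
    then have "r\<^sup>2 * (cnj c + 1) = 0"
      unfolding BJ_orth_M_op_iff[OF U a T] norming_vector_def M_op_zero_unitary[OF cU] cinner_Pair
      by (simp add: unitaryD[OF U] cinner_scaleC_right cinner_self r_def[symmetric]
          algebra_simps power2_eq_square)
    then have "cnj c + 1 = 0" using r by (simp only: mult_eq_0_iff) simp
    then have "cnj c = cnj (- 1)" by (simp only: eq_neg_iff_add_eq_0 complex_cnj_minus complex_cnj_one)
    then have "c = - 1" by (simp only: complex_cnj_cancel_iff)
    then show False using ceq r by (simp add: complex_eq_iff)
  qed
qed

text \<open>Try \<open>T = M_op b (c U)\<close> with \<open>b = \<kappa> a\<close>, \<open>\<kappa> \<noteq> 0\<close>, so that everything happens in one plane.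
  Orthogonality of \<open>M_op a U\<close> to \<open>T\<close> and of \<open>T\<close> to \<open>M_op a U\<close> each determine \<open>c\<close>, and the two
  values agree only if \<open>Im \<kappa> * (1 - 1 / \<bar>\<kappa>\<bar>) = 0\<close>. The value \<open>\<kappa> = \<i> / 2\<close> avoids this and keeps
  \<open>b\<close> inside the unit ball.\<close>

lemma not_left_symmetric_M_op:
  fixes a :: "'a::complex_inner"
  assumes U: "unitary U" and a: "a \<noteq> 0" "norm a < 1"
  shows "\<exists>T\<in>M_set. BJ_orth (M_op a U) T \<and> \<not> BJ_orth T (M_op a U)"
proof -
  define b where "b = (\<i> / 2) *\<^sub>C a"
  define r where "r = norm b"
  have na: "norm a = 2 * r" by (simp add: r_def b_def norm_scaleC norm_divide)
  have r: "r > 0" using a na by (metis mult_zero_right norm_ge_zero norm_eq_zero order_le_less r_def)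
  have ab: "a = (- 2 * \<i>) *\<^sub>C b"
    by (simp add: b_def scaleC_scaleC scaleC_one)
  have b: "b \<noteq> 0" "norm b < 1" using r na a by (auto simp: r_def)
  have nz: "1 - \<i> * complex_of_real r \<noteq> 0" "1 + \<i> * complex_of_real r \<noteq> 0"
    by (auto simp: complex_eq_iff)
  define c where "c = - (1 - \<i> * r) / (1 + \<i> * r)"
  have "cmod (1 + \<i> * r) = cmod (1 - \<i> * r)"
    by (simp add: cmod_def)
  then have c1: "cmod c = 1"
    using nz unfolding c_def norm_divide norm_minus_cancel by simp
  have ceq: "c * (1 + \<i> * r) = - (1 - \<i> * r)"
    using nz by (simp add: c_def)
  have ceq': "cnj c * (1 - \<i> * r) = - (1 + \<i> * r)"
    using arg_cong[OF ceq, of cnj] by simp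
  note cU = unitary_scaleC[OF U c1]
  define T where "T = M_op b (\<lambda>x. c *\<^sub>C U x)"
  have T: "bounded_clinear T" using bounded_clinear_M_op[OF cU] by (simp add: T_def)
  have "cinner (U a, - complex_of_real (norm a)) (T (norming_vector a))
      = 4 * r\<^sup>2 * (cnj c * (1 - \<i> * r) + (1 + \<i> * r))"
    unfolding T_def norming_vector_def na
    unfolding ab M_op_line[OF cU] cinner_Pair
    by (simp add: unitaryD[OF U] cinner_scaleC_left cinner_scaleC_right cinner_self
        r_def[symmetric] algebra_simps power2_eq_square)
  then have "BJ_orth (M_op a U) T"
    unfolding BJ_orth_M_op_iff[OF U a T] by (simp add: ceq')
  moreover have "\<not> BJ_orth T (M_op a U)"
  proof
    assume "BJ_orth T (M_op a U)"
    then have "cinner (c *\<^sub>C U b, - complex_of_real (norm b)) (M_op a U (norming_vector b)) = 0"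
      unfolding T_def BJ_orth_M_op_iff[OF cU b bounded_clinear_M_op[OF U]] .
    then have "r\<^sup>2 * (c * (1 + 2 * \<i> * r) + (1 - 2 * \<i> * r)) = 0"
      unfolding norming_vector_def r_def[symmetric]
      unfolding b_def M_op_line[OF U] cinner_Pair na
      by (simp add: unitaryD[OF U] cinner_scaleC_left cinner_scaleC_right cinner_self
          na algebra_simps power2_eq_square)
    then have "c * (1 + 2 * \<i> * r) = - (1 - 2 * \<i> * r)"
      using r by (simp add: add_eq_0_iff)
    then have "c * (1 + 2 * \<i> * r) * (1 + \<i> * r) = - (1 - 2 * \<i> * r) * (1 + \<i> * r)"
      by (simp only:)
    moreover have "c * (1 + \<i> * r) * (1 + 2 * \<i> * r) = - (1 - \<i> * r) * (1 + 2 * \<i> * r)"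
      by (simp only: ceq)
    moreover have "c * (1 + 2 * \<i> * r) * (1 + \<i> * r) = c * (1 + \<i> * r) * (1 + 2 * \<i> * r)"
      by (simp only: mult_ac)
    ultimately have "- (1 - \<i> * r) * (1 + 2 * \<i> * r) = - (1 - 2 * \<i> * r) * (1 + \<i> * r)"
      by (simp only:)
    then show False using r by (simp add: complex_eq_iff)
  qed
  moreover have "T \<in> M_set"
    using b cU by (simp add: M_op_in_M_set T_def)
  ultimately show ?thesis by blast
qed

text \<open>This is where the space has to be nonzero: a rotation is compared with an operator whose
  parameter \<open>b\<close> is nonzero, by reading the asymmetric pair from the side of the rotation.\<close>

lemma not_left_symmetric_M_op_zero:
  fixes U :: "'a::complex_inner \<Rightarrow> 'a"
  assumes U: "unitary U" and ex: "\<exists>x :: 'a. x \<noteq> 0"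
  shows "\<exists>T\<in>M_set. BJ_orth (M_op 0 U) T \<and> \<not> BJ_orth T (M_op 0 U)"
proof -
  obtain x :: 'a where x: "x \<noteq> 0" using ex by blast
  define b where "b = (1 / (2 * norm x)) *\<^sub>R x"
  have b: "b \<noteq> 0" "norm b < 1" using x by (simp_all add: b_def)
  define c where "c = - (1 + \<i> * norm b) / (1 - \<i> * norm b)"
  have c: "cmod c = 1" by (rule rotation_orth_asymmetric(3)[OF U b c_def])
  define V where "V = (\<lambda>x. cnj c *\<^sub>C U x)"
  have V: "unitary V" unfolding V_def by (rule unitary_scaleC[OF U]) (simp add: c)
  have "c * cnj c = 1" using c by (simp add: complex_norm_square[symmetric])
  then have "(\<lambda>x. c *\<^sub>C V x) = U" by (simp add: V_def scaleC_scaleC scaleC_one)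
  with rotation_orth_asymmetric(1,2)[OF V b c_def] V b show ?thesis
    by (intro bexI[of _ "M_op b V"]) (auto intro: M_op_in_M_set)
qed

theorem theorem1p3:
  assumes "\<exists>x :: 'h::chilbert_space. x \<noteq> 0"
  shows "(\<nexists>S. left_symmetric_in (M_set :: ('h \<times> complex \<Rightarrow> 'h \<times> complex) set) S)
    \<and> {S. right_symmetric_in (M_set :: ('h \<times> complex \<Rightarrow> 'h \<times> complex) set) S} = pure_rotations
    \<and> (\<forall>(a :: 'h) U. a \<in> ball 0 1 \<longrightarrow> unitary U \<longrightarrow>
          (right_symmetric_in M_set (M_op a U) \<longleftrightarrow> a = 0))"
proof -
  have left: "\<not> left_symmetric_in M_set S" for S :: "'h \<times> complex \<Rightarrow> 'h \<times> complex"
  proof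
    assume S: "left_symmetric_in M_set S"
    then obtain a U where "S = M_op a U" "unitary U" "norm a < 1"
      by (auto simp: left_symmetric_in_def M_set_def)
    then have "\<exists>T\<in>M_set. BJ_orth S T \<and> \<not> BJ_orth T S"
      using not_left_symmetric_M_op[of U a] not_left_symmetric_M_op_zero[of U] assms
      by (cases "a = 0") auto
    then show False using S by (auto simp: left_symmetric_in_def)
  qed
  have right: "right_symmetric_in M_set (M_op a U) \<longleftrightarrow> a = 0"
    if "a \<in> ball 0 1" and U: "unitary U" for a :: 'h and U
  proof
    assume R: "right_symmetric_in M_set (M_op a U)"
    show "a = 0"
    proof (rule ccontr)
      assume a: "a \<noteq> 0"
      have a1: "norm a < 1" using that by simp
      define c where "c = - (1 + \<i> * norm a) / (1 - \<i> * norm a)"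
      note rot = rotation_orth_asymmetric[OF U a a1 c_def]
      have "M_op 0 (\<lambda>x. c *\<^sub>C U x) \<in> M_set"
        using unitary_scaleC[OF U rot(3)] by (simp add: M_op_in_M_set)
      then show False using R rot(1,2) by (auto simp: right_symmetric_in_def)
    qed
  qed (use right_symmetric_M_op_zero[OF U] in simp)
  have "{S. right_symmetric_in (M_set :: ('h \<times> complex \<Rightarrow> 'h \<times> complex) set) S} = pure_rotations"
  proof (intro subset_antisym subsetI CollectI)
    fix S :: "'h \<times> complex \<Rightarrow> 'h \<times> complex"
    assume "S \<in> {S. right_symmetric_in M_set S}"
    then have R: "right_symmetric_in M_set S" by simp
    then obtain a U where S: "S = M_op a U" "a \<in> ball 0 1" "unitary U"
      unfolding right_symmetric_in_def M_set_def by blast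
    then have "a = 0" using R right by blast
    with S show "S \<in> pure_rotations" by (auto simp: pure_rotations_def)
  next
    fix S :: "'h \<times> complex \<Rightarrow> 'h \<times> complex"
    assume "S \<in> pure_rotations"
    then show "right_symmetric_in M_set S"
      by (auto simp: pure_rotations_def right_symmetric_M_op_zero)
  qed
  with left right show ?thesis by blast
qed

end
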